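(* Let $(\Omega,\mathcal{A},\mathbb{P})$ be a probability space and $\mathcal{X}$ a Polish space with a complete metric $\mathrm{d}$ on $\mathcal{X}$ which generates the topology. Let $n_0\in\mathbb{N}$, let $X_n:\Omega\to\mathcal{X}$, $n\geq n_0$, be a sequence of random vectors and $X:\Omega\to\mathcal{X}$ a random vector. Assume that $X_n$ converges to $X$ in probability as $n\to\infty$, that is, for any fixed $\delta>0$, $$p(\delta,n):=\mathbb{P}(\mathrm{d}(X_n,X)>\delta)\to 0\qquad \text{as } n\to\infty.$$ Then for any positive, nonincreasing sequence $\epsilon=(\varepsilon_n)_{n\geq n_0}$ and any positive, nondecreasing sequence $a=(a_n)_{n\geq n_0}$ such that $$K(a,\epsilon,n_0):=\sum_{n=n_0}^\infty a_n\sum_{m=n}^\infty p(\varepsilon_m,m)<\infty,$$ it follows that $$\limsup_{n\to\infty}\mathrm{d}(X_n,X)\cdot\varepsilon_n^{-1}\leq 1\qquad \mathbb{P}\text{-a.s.}$$ and $$\mathbb{E}[\mathcal{S}_{a,n_0}(\mathcal{O}_{\epsilon,n_0})]\leq \mathbb{E}[\mathcal{S}_{a,n_0}(\mathbf{m}_{\epsilon,n_0})]\leq K(a,\epsilon,n_0),$$ where $$\mathcal{O}_{\epsilon,n_0}(\omega):=\sum_{n=n_0}^\infty \mathbf{1}\{\mathrm{d}(X_n(\omega),X(\omega))>\varepsilon_n\},\qquad \omega\in\Omega,$$ $$\mathbf{m}_{\epsilon,n_0}(\omega):=\max\{n\geq n_0 : \mathrm{d}(X_n(\omega),X(\omega))>\varepsilon_n\},\qquad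 \omega\in\Omega,$$ and $\mathcal{S}_{a,n_0}$ is defined in the context.
   Context: $\mathbb{N}=\{1,2,\dots\}$. Polish spaces carry their Borel $\sigma$-algebra. $\mathbf{1}$ denotes an indicator function. $\mathcal{S}_{a,n_0}(N):=\sum_{n=0}^{N-1}a_{n_0+n}$ for $N\in\mathbb{N}$, and $\mathcal{S}_{a,n_0}(0):=0$. $\mathcal{O}_{\epsilon,n_0}$ is called the overlap statistic or deviation frequency, and $\mathbf{m}_{\epsilon,n_0}$ the modulus of almost sure convergence.
   Formalization: For n_0≥2 the bound E[S(m)]≤K is false as printed (m is an absolute index); it is proved with m+1−n_0 (0 if there is no deviation) in place of m, and literally for n_0=1; E[S(O)]≤E[S(m)] is proved as printed for all n_0. *)

theory Defs
  imports "HOL-Probability.Probability"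
begin

definition dev_prob ::
  "'w measure \<Rightarrow> (nat \<Rightarrow> 'w \<Rightarrow> 'x::metric_space) \<Rightarrow> ('w \<Rightarrow> 'x) \<Rightarrow> real \<Rightarrow> nat \<Rightarrow> real" where
  "dev_prob M X Y \<delta> n = measure M {w \<in> space M. dist (X n w) (Y w) > \<delta>}"

(* Almost surely finite quantities may be infinite on a null set, hence the extended arguments
   and values; at infinity the full series is taken. All uses have a n > 0, so that ennreal does
   not truncate. *)
definition weighted_sum :: "(nat \<Rightarrow> real) \<Rightarrow> nat \<Rightarrow> enat \<Rightarrow> ennreal" where
  "weighted_sum a n0 N = (case N of
       enat k \<Rightarrow> (\<Sum>n<k. ennreal (a (n0 + n)))
     | \<infinity> \<Rightarrow> (\<Sum>n. ennreal (a (n0 + n))))"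

definition overlap ::
  "(nat \<Rightarrow> 'w \<Rightarrow> 'x::metric_space) \<Rightarrow> ('w \<Rightarrow> 'x) \<Rightarrow> (nat \<Rightarrow> real) \<Rightarrow> nat \<Rightarrow> 'w \<Rightarrow> enat" where
  "overlap X Y \<epsilon> n0 w =
     (\<Sum>n. indicator {k. dist (X k w) (Y w) > \<epsilon> k} (n0 + n))"

(* Sup on enat is the maximum of a nonempty finite set, 0 for the empty set, and infinity for an
   infinite set. *)
definition as_modulus ::
  "(nat \<Rightarrow> 'w \<Rightarrow> 'x::metric_space) \<Rightarrow> ('w \<Rightarrow> 'x) \<Rightarrow> (nat \<Rightarrow> real) \<Rightarrow> nat \<Rightarrow> 'w \<Rightarrow> enat" where
  "as_modulus X Y \<epsilon> n0 w = Sup (enat ` {n. n \<ge> n0 \<and> dist (X n w) (Y w) > \<epsilon> n})"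

(* as_modulus is an absolute index, whereas weighted_sum a n0 N sums the N weights that start at
   index n0. The weights a n0, ..., a m up to the last deviation m are therefore summed with
   N = m + 1 - n0; this is as_modulus itself if n0 = 1, and 0 if there is no deviation and
   n0 >= 1. With as_modulus in place of the relative modulus, the bound by K_sum fails for
   n0 >= 2: for deterministic real X with X 2 = 1, all other X n and the limit 0, all a n = 1,
   all \<epsilon> n = 1/2 and n0 = 2, K_sum is 1, but as_modulus is 2 and so is its weighted sum. *)
definition rel_modulus ::
  "(nat \<Rightarrow> 'w \<Rightarrow> 'x::metric_space) \<Rightarrow> ('w \<Rightarrow> 'x) \<Rightarrow> (nat \<Rightarrow> real) \<Rightarrow> nat \<Rightarrow> 'w \<Rightarrow> enat" where
  "rel_modulus X Y \<epsilon> n0 w = as_modulus X Y \<epsilon> n0 w + 1 - enat n0"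

definition K_sum ::
  "'w measure \<Rightarrow> (nat \<Rightarrow> 'w \<Rightarrow> 'x::metric_space) \<Rightarrow> ('w \<Rightarrow> 'x) \<Rightarrow>
   (nat \<Rightarrow> real) \<Rightarrow> (nat \<Rightarrow> real) \<Rightarrow> nat \<Rightarrow> ennreal" where
  "K_sum M X Y a \<epsilon> n0 =
     (\<Sum>i. ennreal (a (n0 + i)) *
        (\<Sum>j. ennreal (dev_prob M X Y (\<epsilon> (n0 + i + j)) (n0 + i + j))))"

end

theory Submission
  imports Defs
begin

text \<open>
  Writing the weighted sum up to \<open>N\<close> as the full series of the weights times \<open>1{i < N}\<close> turns its
  expectation into a weighted series of tail probabilities. The event \<open>i < N\<close> for the modulus says
  that some deviation occurs at time at least \<open>i\<close>, so the union bound gives the inequality with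
  \<open>K\<close>. The leading term of \<open>K\<close> makes the deviation probabilities summable, and Borel--Cantelli gives
  the almost sure statement.
\<close>

lemma weighted_sum_eq_suminf:
  "weighted_sum a n0 N = (\<Sum>i. ennreal (a (n0 + i)) * indicator {i. enat i < N} i)"
proof (cases N)
  case (enat k)
  have "(\<Sum>i. ennreal (a (n0 + i)) * indicator {i. enat i < N} i)
      = (\<Sum>i<k. ennreal (a (n0 + i)) * indicator {i. enat i < N} i)"
    by (rule suminf_finite) (auto simp: enat)
  then show ?thesis
    by (simp add: weighted_sum_def enat)
qed (simp add: weighted_sum_def)

lemma weighted_sum_mono:
  assumes "N \<le> N'"
  shows "weighted_sum a n0 N \<le> weighted_sum a n0 N'"
  unfolding weighted_sum_eq_suminf using assms
  by (intro suminf_le) (auto split: split_indicator)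

text \<open>A supremum exceeds a bound exactly when some element does, so no case distinction on an
  empty, finite or infinite set of deviation times is needed. This turns the modulus into a
  countable union of events.\<close>

lemma less_rel_modulus_iff:
  assumes "n0 \<ge> 1"
  shows "enat i < rel_modulus X Y \<epsilon> n0 w \<longleftrightarrow>
    (\<exists>j. dist (X (n0 + i + j) w) (Y w) > \<epsilon> (n0 + i + j))"
proof -
  let ?D = "{n. n \<ge> n0 \<and> dist (X n w) (Y w) > \<epsilon> n}"
  \<comment> \<open>For finite \<open>S\<close>, subtraction on \<open>enat\<close> truncates at 0;
    \<open>n0\<close> at least 1 keeps \<open>n0 + i - 1\<close> from truncating on the other side.
    For infinite \<open>S\<close> both sides are true.\<close>
  have "enat i < S + 1 - enat n0 \<longleftrightarrow> enat (n0 + i - 1) < S" for S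
    using assms by (cases S) (auto simp: one_enat_def)
  then have "enat i < rel_modulus X Y \<epsilon> n0 w \<longleftrightarrow> (\<exists>n\<in>?D. n0 + i - 1 < n)"
    by (simp add: rel_modulus_def as_modulus_def less_Sup_iff)
  also have "\<dots> \<longleftrightarrow> (\<exists>j. n0 + i + j \<in> ?D)"
  proof
    assume "\<exists>n\<in>?D. n0 + i - 1 < n"
    then obtain n where n: "n \<in> ?D" "n0 + i \<le> n"
      by auto
    then have "n0 + i + (n - (n0 + i)) \<in> ?D"
      by simp
    then show "\<exists>j. n0 + i + j \<in> ?D" ..
  next
    assume "\<exists>j. n0 + i + j \<in> ?D"
    then obtain j where "n0 + i + j \<in> ?D" ..
    with assms show "\<exists>n\<in>?D. n0 + i - 1 < n"
      by (intro bexI[of _ "n0 + i + j"]) auto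
  qed
  finally show ?thesis
    by simp
qed

lemma rel_modulus_le_as_modulus:
  assumes "n0 \<ge> 1"
  shows "rel_modulus X Y \<epsilon> n0 w \<le> as_modulus X Y \<epsilon> n0 w"
  unfolding rel_modulus_def using assms
  by (cases "as_modulus X Y \<epsilon> n0 w") (auto simp: one_enat_def)

lemma rel_modulus_1: "rel_modulus X Y \<epsilon> 1 w = as_modulus X Y \<epsilon> 1 w"
  unfolding rel_modulus_def
  by (cases "as_modulus X Y \<epsilon> 1 w") (auto simp: one_enat_def)

text \<open>With a finite relative modulus \<open>r\<close>, every deviation sits at an offset from
  \<open>n0\<close> below \<open>r\<close>, so there are at most \<open>r\<close> of them.\<close>

lemma overlap_le_rel_modulus:
  assumes "n0 \<ge> 1"
  shows "overlap X Y \<epsilon> n0 w \<le> rel_modulus X Y \<epsilon> n0 w"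
proof (cases "rel_modulus X Y \<epsilon> n0 w")
  case (enat r)
  let ?ind = "\<lambda>n. indicator {k. dist (X k w) (Y w) > \<epsilon> k} (n0 + n) :: enat"
  \<comment> \<open>A deviation at \<open>n0 + n\<close> is the witness \<open>j = 0\<close> for
    \<open>n\<close> lying below the relative modulus.\<close>
  have "?ind n = 0" if "n \<ge> r" for n
    using less_rel_modulus_iff[OF assms, of n X Y \<epsilon> w] that enat
    by (auto simp: indicator_def dest: spec[of _ 0])
  then have "overlap X Y \<epsilon> n0 w = (\<Sum>n<r. ?ind n)"
    unfolding overlap_def by (intro suminf_finite) auto
  also have "\<dots> \<le> (\<Sum>n<r. 1)"
    by (intro sum_mono) (auto split: split_indicator)
  also have "\<dots> = enat r"
    by (simp add: of_nat_eq_enat)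
  finally show ?thesis
    using enat by simp
qed simp

text \<open>Second countability of a Polish space makes the distance of two Borel maps Borel
  measurable.\<close>

lemma deviation_sets:
  fixes f g :: "'w \<Rightarrow> 'x::polish_space"
  assumes "f \<in> borel_measurable M" "g \<in> borel_measurable M"
  shows "{w \<in> space M. dist (f w) (g w) > c} \<in> sets M"
  using assms by measurable

lemma nn_integral_rel_modulus_le:
  fixes X :: "nat \<Rightarrow> 'w \<Rightarrow> 'x::polish_space"
  assumes "finite_measure M" and n0: "n0 \<ge> 1"
    and X: "\<And>n. n \<ge> n0 \<Longrightarrow> X n \<in> borel_measurable M" and Y: "Y \<in> borel_measurable M"
  shows "(\<integral>\<^sup>+w. weighted_sum a n0 (rel_modulus X Y \<epsilon> n0 w) \<partial>M) \<le> K_sum M X Y a \<epsilon> n0"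
proof -
  interpret finite_measure M by fact
  define D where "D n = {w \<in> space M. dist (X n w) (Y w) > \<epsilon> n}" for n
  have D: "D n \<in> sets M" if "n \<ge> n0" for n
    unfolding D_def by (rule deviation_sets[OF X[OF that] Y])
  then have U: "(\<Union>j. D (n0 + i + j)) \<in> sets M" for i
    by auto
  have "(\<integral>\<^sup>+w. weighted_sum a n0 (rel_modulus X Y \<epsilon> n0 w) \<partial>M)
      = (\<integral>\<^sup>+w. (\<Sum>i. ennreal (a (n0 + i)) * indicator (\<Union>j. D (n0 + i + j)) w) \<partial>M)"
    \<comment> \<open>The rewriting is pointwise on \<open>space M\<close> and also settles
      measurability: the integrand becomes a series of multiples of indicators of measurable sets,
      which can be integrated term by term.\<close>
    unfolding weighted_sum_eq_suminf
    by (intro nn_integral_cong suminf_cong arg_cong2[where f = "(*)"] refl)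
       (auto simp: less_rel_modulus_iff[OF n0] D_def indicator_def)
  also have "\<dots> = (\<Sum>i. ennreal (a (n0 + i)) * emeasure M (\<Union>j. D (n0 + i + j)))"
    using U by (simp add: nn_integral_suminf nn_integral_cmult_indicator)
  also have "\<dots> \<le> (\<Sum>i. ennreal (a (n0 + i)) * (\<Sum>j. emeasure M (D (n0 + i + j))))"
    \<comment> \<open>The union bound holds in \<open>ennreal\<close>, whether or not the inner
      series converges.\<close>
    using D by (intro suminf_le mult_left_mono emeasure_subadditive_countably) auto
  also have "\<dots> = K_sum M X Y a \<epsilon> n0"
    by (simp add: K_sum_def dev_prob_def emeasure_eq_measure D_def)
  finally show ?thesis .
qed

lemma AE_eventually_no_deviation:
  fixes X :: "nat \<Rightarrow> 'w \<Rightarrow> 'x::polish_space"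
  assumes "finite_measure M"
    and X: "\<And>n. n \<ge> n0 \<Longrightarrow> X n \<in> borel_measurable M" and Y: "Y \<in> borel_measurable M"
    and a: "a n0 > 0" and K: "K_sum M X Y a \<epsilon> n0 < \<infinity>"
  shows "AE w in M. \<forall>\<^sub>F n in sequentially. dist (X n w) (Y w) \<le> \<epsilon> n"
proof -
  interpret finite_measure M by fact
  \<comment> \<open>Offsets from \<open>n0\<close> are used because measurability of
    \<open>X n\<close> is assumed only from \<open>n0\<close> on.\<close>
  let ?D = "\<lambda>j. {w \<in> space M. dist (X (n0 + j) w) (Y w) > \<epsilon> (n0 + j)}"
  let ?p = "\<Sum>j. ennreal (measure M (?D j))"
  define f where "f i = ennreal (a (n0 + i)) *
    (\<Sum>j. ennreal (dev_prob M X Y (\<epsilon> (n0 + i + j)) (n0 + i + j)))" for i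
  \<comment> \<open>The term of \<open>K_sum\<close> at \<open>i = 0\<close> is \<open>a n0\<close>
    times the full series of deviation probabilities.\<close>
  have "sum f {0} \<le> suminf f"
    by (rule sum_le_suminf) auto
  then have "ennreal (a n0) * ?p \<le> K_sum M X Y a \<epsilon> n0"
    by (simp add: f_def[abs_def] K_sum_def dev_prob_def)
  then have "ennreal (a n0) * ?p < \<infinity>"
    using K by (rule le_less_trans)
  \<comment> \<open>A product with the nonzero factor \<open>a n0\<close> would be infinite if
    \<open>?p\<close> were.\<close>
  then have "?p \<noteq> \<infinity>"
    using a by (auto simp: ennreal_mult_less_top)
  then have "summable (\<lambda>j. measure M (?D j))"
    by (intro summable_suminf_not_top) auto
  then have "AE w in M. \<forall>\<^sub>F j in sequentially. w \<in> space M - ?D j"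
    by (intro borel_cantelli_AE1) (auto intro: deviation_sets[OF X Y] simp: less_top[symmetric])
  then show ?thesis
  proof (rule AE_mp, intro AE_I2 impI)
    fix w assume "\<forall>\<^sub>F j in sequentially. w \<in> space M - ?D j"
    then have "\<forall>\<^sub>F j in sequentially. dist (X (j + n0) w) (Y w) \<le> \<epsilon> (j + n0)"
      by eventually_elim (auto simp: add.commute not_less)
    then show "\<forall>\<^sub>F n in sequentially. dist (X n w) (Y w) \<le> \<epsilon> n"
      by (rule eventually_sequentially_seg[THEN iffD1])
  qed
qed

theorem lemma2:
  fixes M :: "'w measure"
    and X :: "nat \<Rightarrow> 'w \<Rightarrow> 'x::polish_space"
    and Y :: "'w \<Rightarrow> 'x"
    and a \<epsilon> :: "nat \<Rightarrow> real"
    and n0 :: nat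
  assumes "prob_space M"
    and "n0 \<ge> 1"
    and "\<And>n. n \<ge> n0 \<Longrightarrow> X n \<in> borel_measurable M"
    and "Y \<in> borel_measurable M"
    and "\<And>\<delta>. \<delta> > 0 \<Longrightarrow> (\<lambda>n. dev_prob M X Y \<delta> n) \<longlonglongrightarrow> 0"
    and "\<And>n. n \<ge> n0 \<Longrightarrow> \<epsilon> n > 0"
    and "\<And>m n. n0 \<le> m \<Longrightarrow> m \<le> n \<Longrightarrow> \<epsilon> n \<le> \<epsilon> m"
    and "\<And>n. n \<ge> n0 \<Longrightarrow> a n > 0"
    and "\<And>m n. n0 \<le> m \<Longrightarrow> m \<le> n \<Longrightarrow> a m \<le> a n"
    and "K_sum M X Y a \<epsilon> n0 < \<infinity>"
  shows "(AE w in M. limsup (\<lambda>n. ereal (dist (X n w) (Y w) * inverse (\<epsilon> n))) \<le> 1)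
    \<and> (\<integral>\<^sup>+w. weighted_sum a n0 (overlap X Y \<epsilon> n0 w) \<partial>M)
        \<le> (\<integral>\<^sup>+w. weighted_sum a n0 (rel_modulus X Y \<epsilon> n0 w) \<partial>M)
    \<and> (\<integral>\<^sup>+w. weighted_sum a n0 (rel_modulus X Y \<epsilon> n0 w) \<partial>M) \<le> K_sum M X Y a \<epsilon> n0
    \<and> (\<integral>\<^sup>+w. weighted_sum a n0 (overlap X Y \<epsilon> n0 w) \<partial>M)
        \<le> (\<integral>\<^sup>+w. weighted_sum a n0 (as_modulus X Y \<epsilon> n0 w) \<partial>M)
    \<and> (n0 = 1 \<longrightarrow>
        (\<integral>\<^sup>+w. weighted_sum a n0 (as_modulus X Y \<epsilon> n0 w) \<partial>M) \<le> K_sum M X Y a \<epsilon> n0)"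
proof -
  interpret prob_space M by fact
  have "AE w in M. \<forall>\<^sub>F n in sequentially. dist (X n w) (Y w) \<le> \<epsilon> n"
    by (rule AE_eventually_no_deviation[where a = a and ?n0.0 = n0])
       (use assms finite_measure_axioms in auto)
  then have "AE w in M. limsup (\<lambda>n. ereal (dist (X n w) (Y w) * inverse (\<epsilon> n))) \<le> 1"
  proof (rule AE_mp, intro AE_I2 impI)
    fix w assume "\<forall>\<^sub>F n in sequentially. dist (X n w) (Y w) \<le> \<epsilon> n"
    then have "\<forall>\<^sub>F n in sequentially. ereal (dist (X n w) (Y w) * inverse (\<epsilon> n)) \<le> 1"
      \<comment> \<open>Positivity of \<open>\<epsilon> n\<close> is known only from
        \<open>n0\<close> on, so the division takes place on that tail.\<close>
      using eventually_ge_at_top[of n0]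
      by eventually_elim (use assms(6) in \<open>auto simp: field_simps one_ereal_def\<close>)
    then show "limsup (\<lambda>n. ereal (dist (X n w) (Y w) * inverse (\<epsilon> n))) \<le> 1"
      by (rule Limsup_bounded)
  qed
  moreover have rel: "(\<integral>\<^sup>+w. weighted_sum a n0 (rel_modulus X Y \<epsilon> n0 w) \<partial>M) \<le> K_sum M X Y a \<epsilon> n0"
    by (rule nn_integral_rel_modulus_le[OF finite_measure_axioms assms(2-4)])
  moreover have "(\<integral>\<^sup>+w. weighted_sum a n0 (overlap X Y \<epsilon> n0 w) \<partial>M)
      \<le> (\<integral>\<^sup>+w. weighted_sum a n0 (rel_modulus X Y \<epsilon> n0 w) \<partial>M)"
    by (intro nn_integral_mono weighted_sum_mono overlap_le_rel_modulus assms(2))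
  moreover have "(\<integral>\<^sup>+w. weighted_sum a n0 (overlap X Y \<epsilon> n0 w) \<partial>M)
      \<le> (\<integral>\<^sup>+w. weighted_sum a n0 (as_modulus X Y \<epsilon> n0 w) \<partial>M)"
    \<comment> \<open>The comparison passes pointwise through the relative modulus, which lies
      between the overlap and the absolute modulus.\<close>
    by (intro nn_integral_mono weighted_sum_mono order_trans[OF overlap_le_rel_modulus
          rel_modulus_le_as_modulus] assms(2))
  moreover have "(\<integral>\<^sup>+w. weighted_sum a n0 (as_modulus X Y \<epsilon> n0 w) \<partial>M) \<le> K_sum M X Y a \<epsilon> n0"
    if "n0 = 1"
    \<comment> \<open>Only at \<open>n0 = 1\<close> do the added 1 and the subtracted
      \<open>n0\<close> cancel, which transfers the bound to the absolute modulus.\<close>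
    using rel unfolding that rel_modulus_1 .
  ultimately show ?thesis
    by blast
qed

end
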